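(* Let $F\in\mathcal{H}^d$ and $A=\mathcal{A}(F)$. If $\rho(A)<1$, then there exist $\boldsymbol{\lambda}\in\mathbb{R}^d_{++}$ and $\mathbf{u}\in\mathcal{S}_{++}$ such that $F(\mathbf{u})=\boldsymbol{\lambda}\otimes\mathbf{u}$. Moreover, there exists $\mathbf{b}\in\mathbb{R}^d_{++}$ such that $A^T\mathbf{b}\le\mathbf{b}$, and for every such $\mathbf{b}$ it holds $$\min_{\mathbf{x}\in\mathcal{S}_{++}}\check{\mathrm{cw}}_{\mathbf{b}}(F,\mathbf{x})=\prod_{i=1}^d\lambda_i^{b_i}=\max_{\mathbf{x}\in\mathcal{S}_+}\widehat{\mathrm{cw}}_{\mathbf{b}}(F,\mathbf{x}).$$
   Context: $[n]=\{1,\ldots,n\}$; $\rho$ is the spectral radius. Fix positive integers $d,n_1,\ldots,n_d$. Let $\mathcal{K}_+=\mathbb{R}^{n_1}_+\times\cdots\times\mathbb{R}^{n_d}_+$ (nonnegative entries), $\mathcal{K}_{+,0}=(\mathbb{R}^{n_1}_+\setminus\{0\})\times\cdots\times(\mathbb{R}^{n_d}_+\setminus\{0\})$, $\mathcal{K}_{++}=\mathbb{R}^{n_1}_{++}\times\cdots\times\mathbb{R}^{n_d}_{++}$ (positive entries). Write $\mathbf{x}=(\mathbf{x}_1,\ldots,\mathbf{x}_d)$, $\mathbf{x}_i=(x_{i,1},\ldots,x_{i,n_i})$, and $F_{i,j_i}$ for the components of $F$. $\mathbf{x}\le\mathbf{y}$ means $\mathbf{y}-\mathbf{x}$ has nonnegative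 entries. For $\boldsymbol{\alpha}\in\mathbb{R}^d$, $\boldsymbol{\alpha}\otimes\mathbf{x}=(\alpha_1\mathbf{x}_1,\ldots,\alpha_d\mathbf{x}_d)$. For $\boldsymbol{\alpha}\in\mathbb{R}^d_{++}$ and $B\in\mathbb{R}^{d\times d}$, $\boldsymbol{\alpha}^B=(\prod_{k}\alpha_k^{B_{1,k}},\ldots,\prod_k\alpha_k^{B_{d,k}})$. $\mathbf{1}$ is the vector of all ones. $F\colon\mathcal{K}_+\to\mathcal{K}_+$ is order-preserving if $\mathbf{x}\le\mathbf{y}$ implies $F(\mathbf{x})\le F(\mathbf{y})$; it is multi-homogeneous with homogeneity matrix $\mathcal{A}(F)=A\in\mathbb{R}^{d\times d}$ if $F(\boldsymbol{\alpha}\otimes\mathbf{x})=\boldsymbol{\alpha}^A\otimes F(\mathbf{x})$ for all $\mathbf{x}\in\mathcal{K}_+$, $\boldsymbol{\alpha}\in\mathbb{R}^d_{++}$. $\mathcal{H}^d$ is the set of $F\colon\mathcal{K}_+\to\mathcal{K}_+$ that are continuous, order-preserving and multi-homogeneous, with $F(\mathbf{1})\in\mathcal{K}_{++}$ and such that $\mathcal{A}(F)$ has at least one nonzero entry per row. For each $i$, $\|\cdot\|_{\gamma_i}$ is a norm on $\mathbb{R}^{n_i}$, assumed monotonic ($0\le\mathbf{x}_i\le\mathbf{y}_i$ implies $\|\mathbf{x}_i\|_{\gamma_i}\le\|\mathbf{y}_i\|_{\gamma_i}$); $\mathcal{S}_+=\{\mathbf{x}\in\mathcal{K}_+:\|\mathbf{x}_i\|_{\gamma_i}=1\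 \forall i\in[d]\}$ and $\mathcal{S}_{++}=\mathcal{S}_+\cap\mathcal{K}_{++}$. For $\mathbf{u}\in\mathcal{K}_{++}$ and $\mathbf{x}\in\mathcal{K}_{+,0}$, $$\check{\mathrm{cw}}_{\mathbf{b}}(F,\mathbf{u})=\prod_{i=1}^d\Big(\max_{j_i\in[n_i]}\frac{F_{i,j_i}(\mathbf{u})}{u_{i,j_i}}\Big)^{b_i},\qquad \widehat{\mathrm{cw}}_{\mathbf{b}}(F,\mathbf{x})=\prod_{i=1}^d\Big(\min_{j_i\in[n_i],\,x_{i,j_i}>0}\frac{F_{i,j_i}(\mathbf{x})}{x_{i,j_i}}\Big)^{b_i}.$$ *)

theory Defs
  imports
    "HOL-Analysis.Function_Topology"
    "HOL-Library.FuncSet"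
    "Jordan_Normal_Form.Spectral_Radius"
begin

text \<open>
  The index sets $[d]$ and $[n_i]$ are rendered as \<^term>\<open>{..<d}\<close> and \<^term>\<open>{..<n i}\<close>.

  An element of the product of the spaces $R^{n_i}$, whose dimensions vary with $i$, is a function
  \<^term>\<open>x :: nat \<Rightarrow> nat \<Rightarrow> real\<close> that vanishes outside the index set.  On such functions the library's
  pointwise order is the componentwise order, and the subspace topology of the
  library's product topology is the Euclidean one, since all but finitely many coordinates are
  constant.  Vectors of $R^d$ and matrices are those of \<^theory>\<open>Jordan_Normal_Form.Matrix\<close>.
\<close>

definition block_space :: "nat \<Rightarrow> (nat \<Rightarrow> real) set" where
  "block_space m = {v. \<forall>j\<ge>m. v j = 0}"

definition product_space :: "nat \<Rightarrow> (nat \<Rightarrow> nat) \<Rightarrow> (nat \<Rightarrow> nat \<Rightarrow> real) set" where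
  "product_space d n = {x. (\<forall>i<d. x i \<in> block_space (n i)) \<and> (\<forall>i\<ge>d. \<forall>j. x i j = 0)}"

definition K_plus :: "nat \<Rightarrow> (nat \<Rightarrow> nat) \<Rightarrow> (nat \<Rightarrow> nat \<Rightarrow> real) set" where
  "K_plus d n = {x \<in> product_space d n. \<forall>i<d. \<forall>j<n i. 0 \<le> x i j}"

definition K_pos :: "nat \<Rightarrow> (nat \<Rightarrow> nat) \<Rightarrow> (nat \<Rightarrow> nat \<Rightarrow> real) set" where
  "K_pos d n = {x \<in> product_space d n. \<forall>i<d. \<forall>j<n i. 0 < x i j}"

definition pos_vec :: "nat \<Rightarrow> real vec set" where
  "pos_vec d = {\<alpha> \<in> carrier_vec d. \<forall>i<d. 0 < \<alpha> $ i}"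

definition ones :: "nat \<Rightarrow> (nat \<Rightarrow> nat) \<Rightarrow> nat \<Rightarrow> nat \<Rightarrow> real" where
  "ones d n = (\<lambda>i j. if i < d \<and> j < n i then 1 else 0)"

text \<open>The case distinction only makes the zero padding outside of $[d]$ explicit.\<close>

definition block_scale :: "real vec \<Rightarrow> (nat \<Rightarrow> nat \<Rightarrow> real) \<Rightarrow> nat \<Rightarrow> nat \<Rightarrow> real"
    (infixr "\<otimes>\<^sub>b" 75) where
  "\<alpha> \<otimes>\<^sub>b x = (\<lambda>i j. if i < dim_vec \<alpha> then \<alpha> $ i * x i j else 0)"

definition vec_powr :: "real vec \<Rightarrow> real mat \<Rightarrow> real vec" where
  "vec_powr \<alpha> B = vec (dim_row B) (\<lambda>i. \<Prod>k<dim_col B. (\<alpha> $ k) powr (B $$ (i, k)))"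

definition multi_homogeneous ::
  "nat \<Rightarrow> (nat \<Rightarrow> nat) \<Rightarrow> ((nat \<Rightarrow> nat \<Rightarrow> real) \<Rightarrow> nat \<Rightarrow> nat \<Rightarrow> real) \<Rightarrow> real mat \<Rightarrow> bool" where
  "multi_homogeneous d n F A \<longleftrightarrow>
     A \<in> carrier_mat d d \<and>
     (\<forall>x\<in>K_plus d n. \<forall>\<alpha>\<in>pos_vec d. F (\<alpha> \<otimes>\<^sub>b x) = vec_powr \<alpha> A \<otimes>\<^sub>b F x)"

text \<open>
  Only the values of \<^term>\<open>F\<close> on \<^term>\<open>K_plus d n\<close> matter.  The matrix \<^term>\<open>A\<close> below is
  unique, see \<open>homogeneity_matrix_unique\<close>, so it is the homogeneity matrix of \<^term>\<open>F\<close>.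
\<close>

definition H_class ::
  "nat \<Rightarrow> (nat \<Rightarrow> nat) \<Rightarrow> ((nat \<Rightarrow> nat \<Rightarrow> real) \<Rightarrow> nat \<Rightarrow> nat \<Rightarrow> real) set" where
  "H_class d n = {F. F \<in> K_plus d n \<rightarrow> K_plus d n \<and>
     continuous_on (K_plus d n) F \<and>
     mono_on (K_plus d n) F \<and>
     F (ones d n) \<in> K_pos d n \<and>
     (\<exists>A. multi_homogeneous d n F A \<and> (\<forall>i<d. \<exists>k<d. A $$ (i, k) \<noteq> 0))}"

lemma homogeneity_matrix_unique:
  assumes n: "\<forall>i<d. 1 \<le> n i"
    and F1: "F (ones d n) \<in> K_pos d n"
    and A: "multi_homogeneous d n F A"
    and B: "multi_homogeneous d n F B"
  shows "A = B"
proof -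
  have Ac: "A \<in> carrier_mat d d" and Bc: "B \<in> carrier_mat d d"
    using A B by (auto simp: multi_homogeneous_def)
  have ones: "ones d n \<in> K_plus d n"
    by (auto simp: ones_def K_plus_def product_space_def block_space_def)
  have eq: "A $$ (i, k) = B $$ (i, k)" if i: "i < d" and k: "k < d" for i k
  proof -
    define \<alpha> :: "real vec" where "\<alpha> = vec d (\<lambda>l. if l = k then 2 else 1)"
    have \<alpha>: "\<alpha> \<in> pos_vec d"
      by (auto simp: \<alpha>_def pos_vec_def)
    have pow: "vec_powr \<alpha> C $ i = 2 powr (C $$ (i, k))" if "C \<in> carrier_mat d d" for C
    proof -
      have "vec_powr \<alpha> C $ i = (\<Prod>l<d. (\<alpha> $ l) powr (C $$ (i, l)))"
        using that i by (simp add: vec_powr_def)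
      also have "\<dots> = (\<Prod>l<d. if l = k then 2 powr (C $$ (i, l)) else 1)"
        by (intro prod.cong) (auto simp: \<alpha>_def)
      finally have "vec_powr \<alpha> C $ i = (\<Prod>l<d. if l = k then 2 powr (C $$ (i, l)) else 1)" .
      then show ?thesis
        using k by simp
    qed
    have "(vec_powr \<alpha> A \<otimes>\<^sub>b F (ones d n)) i 0 = (vec_powr \<alpha> B \<otimes>\<^sub>b F (ones d n)) i 0"
      using A B \<alpha> ones by (metis multi_homogeneous_def)
    moreover have "F (ones d n) i 0 > 0"
      using F1 i n by (fastforce simp: K_pos_def)
    ultimately have "vec_powr \<alpha> A $ i = vec_powr \<alpha> B $ i"
      using i Ac Bc by (simp add: block_scale_def vec_powr_def)
    then show ?thesis
      using pow[OF Ac] pow[OF Bc] by (simp add: powr_inj)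
  qed
  show ?thesis
    using Ac Bc eq by (intro eq_matI) auto
qed

definition is_norm_on :: "nat \<Rightarrow> ((nat \<Rightarrow> real) \<Rightarrow> real) \<Rightarrow> bool" where
  "is_norm_on m N \<longleftrightarrow>
     (\<forall>v\<in>block_space m. 0 \<le> N v \<and> (N v = 0 \<longleftrightarrow> v = (\<lambda>_. 0))) \<and>
     (\<forall>v\<in>block_space m. \<forall>c. N (\<lambda>j. c * v j) = \<bar>c\<bar> * N v) \<and>
     (\<forall>v\<in>block_space m. \<forall>w\<in>block_space m. N (\<lambda>j. v j + w j) \<le> N v + N w)"

definition monotonic_norm_on :: "nat \<Rightarrow> ((nat \<Rightarrow> real) \<Rightarrow> real) \<Rightarrow> bool" where
  "monotonic_norm_on m N \<longleftrightarrow>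
     is_norm_on m N \<and>
     (\<forall>v\<in>block_space m. \<forall>w\<in>block_space m. (\<lambda>_. 0) \<le> v \<and> v \<le> w \<longrightarrow> N v \<le> N w)"

definition S_plus ::
  "nat \<Rightarrow> (nat \<Rightarrow> nat) \<Rightarrow> (nat \<Rightarrow> (nat \<Rightarrow> real) \<Rightarrow> real) \<Rightarrow> (nat \<Rightarrow> nat \<Rightarrow> real) set" where
  "S_plus d n \<gamma> = {x \<in> K_plus d n. \<forall>i<d. \<gamma> i (x i) = 1}"

definition S_pos ::
  "nat \<Rightarrow> (nat \<Rightarrow> nat) \<Rightarrow> (nat \<Rightarrow> (nat \<Rightarrow> real) \<Rightarrow> real) \<Rightarrow> (nat \<Rightarrow> nat \<Rightarrow> real) set" where
  "S_pos d n \<gamma> = S_plus d n \<gamma> \<inter> K_pos d n"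

text \<open>
  \<open>cw_upper\<close> is meant for arguments in \<^term>\<open>K_pos d n\<close>, \<open>cw_lower\<close> for arguments in
  \<^term>\<open>K_plus d n\<close> with no zero block (such as those in \<^term>\<open>S_plus d n \<gamma>\<close>), so that the extrema
  range over nonempty sets.  The powers have nonnegative bases and, for positive \<^term>\<open>b\<close>,
  \<open>0 powr b = 0\<close> is the intended value.
\<close>

definition cw_upper ::
  "nat \<Rightarrow> (nat \<Rightarrow> nat) \<Rightarrow> real vec \<Rightarrow> ((nat \<Rightarrow> nat \<Rightarrow> real) \<Rightarrow> nat \<Rightarrow> nat \<Rightarrow> real) \<Rightarrow>
   (nat \<Rightarrow> nat \<Rightarrow> real) \<Rightarrow> real" where
  "cw_upper d n b F u = (\<Prod>i<d. (Max {F u i j / u i j | j. j < n i}) powr (b $ i))"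

definition cw_lower ::
  "nat \<Rightarrow> (nat \<Rightarrow> nat) \<Rightarrow> real vec \<Rightarrow> ((nat \<Rightarrow> nat \<Rightarrow> real) \<Rightarrow> nat \<Rightarrow> nat \<Rightarrow> real) \<Rightarrow>
   (nat \<Rightarrow> nat \<Rightarrow> real) \<Rightarrow> real" where
  "cw_lower d n b F x = (\<Prod>i<d. (Min {F x i j / x i j | j. j < n i \<and> 0 < x i j}) powr (b $ i))"

definition is_minimum_over :: "'a set \<Rightarrow> ('a \<Rightarrow> real) \<Rightarrow> real \<Rightarrow> bool" where
  "is_minimum_over S f m \<longleftrightarrow> m \<in> f ` S \<and> (\<forall>x\<in>S. m \<le> f x)"

definition is_maximum_over :: "'a set \<Rightarrow> ('a \<Rightarrow> real) \<Rightarrow> real \<Rightarrow> bool" where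
  "is_maximum_over S f m \<longleftrightarrow> m \<in> f ` S \<and> (\<forall>x\<in>S. f x \<le> m)"

end

theory Submission
  imports Defs
begin

text \<open>
  Taking logarithms of the scaling factors of the blocks turns \<open>F\<close> into a perturbation of the linear
  map \<open>A\<close>, and \<open>\<rho>(A) < 1\<close> makes this map contracting.  Therefore \<open>F\<close>
  itself has a fixed point in the interior of the cone.

  The matrix \<open>A\<close> is nonnegative since \<open>F\<close> is order-preserving (\<open>homogeneity_matrix_nonneg\<close>), so
  truncating the Neumann series of \<open>(I - A)\<^sup>-\<^sup>1\<close> yields positive vectors \<open>v\<close> with \<open>A v < v\<close> and,
  applied to the transpose, \<open>b\<close> with \<open>A\<^sup>T b < b\<close> (\<open>ex_positive_strict_subinvariant\<close>).  The
  vector \<open>v\<close> gives a sub-solution and a super-solution of \<open>F x = x\<close> with positive entries, and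
  monotonicity gives a fixed point between them (\<open>ex_positive_fixed_point\<close>).  By homogeneity, dividing
  its blocks by their norms turns it into an eigenvector \<open>u\<close> with eigenvalues \<open>l\<close>
  (\<open>ex_normalized_eigenvector\<close>).

  The value \<open>\<Prod> l\<^sub>i powr b\<^sub>i\<close> is attained at \<open>u\<close> by both Collatz-Wielandt functions.  That it is extremal
  follows, for the minimum and the maximum, from one inequality between the growth of \<open>F\<close> at two points of
  equal block norms (\<open>weighted_growth_comparison\<close>).
\<close>

section \<open>Powers of a matrix with small spectral radius\<close>

lemma spectral_radius_smult_less_one:
  fixes B :: "complex mat" and s :: real
  assumes B: "B \<in> carrier_mat d d" and d: "0 < d" and s: "0 < s"
    and less: "s * spectral_radius B < 1"
  shows "spectral_radius (complex_of_real s \<cdot>\<^sub>m B) < 1"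
proof -
  have sB: "complex_of_real s \<cdot>\<^sub>m B \<in> carrier_mat d d"
    using B by simp
  obtain k where k: "eigenvalue (complex_of_real s \<cdot>\<^sub>m B) k"
    and rad: "spectral_radius (complex_of_real s \<cdot>\<^sub>m B) = norm k"
    using spectral_radius_mem_max(1)[OF sB d] by (auto simp: spectrum_def)
  obtain v where v: "v \<in> carrier_vec d" "v \<noteq> 0\<^sub>v d"
    and ev: "(complex_of_real s \<cdot>\<^sub>m B) *\<^sub>v v = k \<cdot>\<^sub>v v"
    using k B unfolding eigenvalue_def eigenvector_def by auto
  have "(complex_of_real s \<cdot>\<^sub>m B) *\<^sub>v v = complex_of_real s \<cdot>\<^sub>v (B *\<^sub>v v)"
    using B v by (intro eq_vecI) (auto simp: scalar_prod_def sum_distrib_left ac_simps)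
  with ev have "complex_of_real s \<cdot>\<^sub>v (B *\<^sub>v v) = k \<cdot>\<^sub>v v"
    by simp
  then have "(1 / complex_of_real s) \<cdot>\<^sub>v (complex_of_real s \<cdot>\<^sub>v (B *\<^sub>v v))
      = (1 / complex_of_real s) \<cdot>\<^sub>v (k \<cdot>\<^sub>v v)"
    by simp
  then have "B *\<^sub>v v = (k / complex_of_real s) \<cdot>\<^sub>v v"
    using s by (simp add: smult_smult_assoc)
  then have "eigenvalue B (k / complex_of_real s)"
    using v B unfolding eigenvalue_def eigenvector_def by auto
  then have "norm (k / complex_of_real s) \<le> spectral_radius B"
    using spectral_radius_mem_max(2)[OF B d] by (simp add: spectrum_def)
  then have "norm k \<le> s * spectral_radius B"
    using s by (simp add: norm_divide field_simps)
  with less rad show ?thesis by simp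
qed

lemma pow_smult_mat:
  fixes B :: "'a::comm_semiring_1 mat"
  assumes B: "B \<in> carrier_mat d d"
  shows "(s \<cdot>\<^sub>m B) ^\<^sub>m k = s ^ k \<cdot>\<^sub>m (B ^\<^sub>m k)"
proof (induction k)
  case 0
  then show ?case using B by (intro eq_matI) auto
next
  case (Suc k)
  have Bk: "B ^\<^sub>m k \<in> carrier_mat d d" using B by simp
  have "(s \<cdot>\<^sub>m B) ^\<^sub>m Suc k = (s ^ k \<cdot>\<^sub>m (B ^\<^sub>m k)) * (s \<cdot>\<^sub>m B)"
    using Suc by simp
  also have "\<dots> = s ^ k \<cdot>\<^sub>m (s \<cdot>\<^sub>m ((B ^\<^sub>m k) * B))"
    using mult_smult_assoc_mat[OF Bk, of "s \<cdot>\<^sub>m B" d "s ^ k"] mult_smult_distrib[OF Bk B] B by simp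
  also have "\<dots> = s ^ Suc k \<cdot>\<^sub>m (B ^\<^sub>m Suc k)"
    by (intro eq_matI) (auto simp: ac_simps)
  finally show ?case .
qed

text \<open>
  By the Jordan normal form, the powers of a matrix of spectral radius less than one are bounded.
  As the condition is open, this also applies to \<open>s A\<close> for some \<open>s > 1\<close>, so the entries of \<open>A ^ k\<close> are
  at most \<open>c / s ^ k\<close> in absolute value.
\<close>

lemma small_power_of_spectral_radius_less_one:
  fixes A :: "real mat"
  assumes A: "A \<in> carrier_mat d d" and d: "0 < d"
    and rad: "spectral_radius (map_mat complex_of_real A) < 1" and e: "0 < e"
  shows "\<exists>N. \<forall>i<d. \<forall>j<d. \<bar>(A ^\<^sub>m N) $$ (i, j)\<bar> < e"
proof -
  let ?B = "map_mat complex_of_real A"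
  let ?r = "spectral_radius ?B"
  have B: "?B \<in> carrier_mat d d" using A by simp
  have r0: "0 \<le> ?r"
    using spectral_radius_mem_max(1)[OF B d] by auto
  \<comment> \<open>Any \<open>s > 1\<close> with \<open>s r < 1\<close> works; this choice also covers \<open>r = 0\<close>.\<close>
  define s where "s = 2 / (1 + ?r)"
  have s: "1 < s" and sr: "s * ?r < 1"
    using r0 rad by (auto simp: s_def field_simps)
  have "spectral_radius (complex_of_real s \<cdot>\<^sub>m ?B) < 1"
    using spectral_radius_smult_less_one[OF B d _ sr] s by simp
  then obtain c where c: "\<And>k. norm_bound ((complex_of_real s \<cdot>\<^sub>m ?B) ^\<^sub>m k) c"
    using spectral_radius_jnf_norm_bound_less_1_upper_triangular[of "complex_of_real s \<cdot>\<^sub>m ?B" d] B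
    by auto
  have bound: "s ^ k * \<bar>(A ^\<^sub>m k) $$ (i, j)\<bar> \<le> c" if ij: "i < d" "j < d" for i j k
  proof -
    have Ak: "A ^\<^sub>m k \<in> carrier_mat d d" and Bk: "?B ^\<^sub>m k \<in> carrier_mat d d"
      using A by auto
    have sBk: "(complex_of_real s \<cdot>\<^sub>m ?B) ^\<^sub>m k \<in> carrier_mat d d"
      using B by (intro pow_carrier_mat) simp
    have "norm (((complex_of_real s \<cdot>\<^sub>m ?B) ^\<^sub>m k) $$ (i, j)) \<le> c"
      using c[of k] ij carrier_matD[OF sBk] unfolding norm_bound_def by metis
    also have "((complex_of_real s \<cdot>\<^sub>m ?B) ^\<^sub>m k) $$ (i, j)
        = complex_of_real (s ^ k * (A ^\<^sub>m k) $$ (i, j))"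
      using ij A Ak Bk
      by (simp add: pow_smult_mat[OF B] flip: of_real_hom.mat_hom_pow[OF A])
    finally show ?thesis
      using s by (simp add: norm_mult abs_mult norm_power)
  qed
  obtain N where N: "c / e < s ^ N"
    using real_arch_pow[OF s] by blast
  have "\<bar>(A ^\<^sub>m N) $$ (i, j)\<bar> < e" if ij: "i < d" "j < d" for i j
  proof -
    have "s ^ N * \<bar>(A ^\<^sub>m N) $$ (i, j)\<bar> < s ^ N * e"
      using bound[OF ij, of N] N e by (simp add: field_simps)
    then show ?thesis using s by simp
  qed
  then show ?thesis by blast
qed

text \<open>
  This replaces a Perron vector, which need not be positive for a reducible matrix.  The truncated
  Neumann series \<open>b = (I + A\<^sup>T + \<dots> + (A\<^sup>T)\<^sup>N\<^sup>-\<^sup>1) 1\<close> satisfies \<open>A\<^sup>T b = b - 1 + (A\<^sup>T)\<^sup>N 1\<close>, and the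
  last summand is small for suitable \<open>N\<close>.
\<close>

lemma ex_positive_strict_subinvariant:
  fixes A :: "real mat"
  assumes A: "A \<in> carrier_mat d d" and d: "0 < d"
    and nonneg: "\<And>i j. i < d \<Longrightarrow> j < d \<Longrightarrow> 0 \<le> A $$ (i, j)"
    and rad: "spectral_radius (map_mat complex_of_real A) < 1"
  shows "\<exists>b. \<forall>j<d. 0 < b j \<and> (\<Sum>i<d. b i * A $$ (i, j)) < b j"
proof -
  obtain N where N: "\<And>i j. i < d \<Longrightarrow> j < d \<Longrightarrow> \<bar>(A ^\<^sub>m N) $$ (i, j)\<bar> < 1 / real d"
    using small_power_of_spectral_radius_less_one[OF A d rad, of "1 / real d"] d by auto
  define c where "c k j = (\<Sum>i<d. (A ^\<^sub>m k) $$ (i, j))" for k j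
  define b where "b j = (\<Sum>k<N. c k j)" for j
  have pow_nonneg: "0 \<le> (A ^\<^sub>m k) $$ (i, j)" if "i < d" "j < d" for i j k
    using that
  proof (induction k arbitrary: j)
    case 0
    then show ?case using A by simp
  next
    case (Suc k)
    have Ak: "A ^\<^sub>m k \<in> carrier_mat d d" using A by simp
    show ?case
      using Suc A Ak nonneg by (auto simp: scalar_prod_def intro!: sum_nonneg)
  qed
  have c0: "c 0 j = 1" if "j < d" for j
    using that A by (simp add: c_def)
  have c_nonneg: "0 \<le> c k j" if "j < d" for k j
    using that pow_nonneg by (auto simp: c_def intro!: sum_nonneg)
  have c_Suc: "(\<Sum>l<d. c k l * A $$ (l, j)) = c (Suc k) j" if j: "j < d" for k j
  proof -
    have Ak: "A ^\<^sub>m k \<in> carrier_mat d d" using A by simp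
    have "(\<Sum>l<d. c k l * A $$ (l, j)) = (\<Sum>l<d. \<Sum>i<d. (A ^\<^sub>m k) $$ (i, l) * A $$ (l, j))"
      by (simp add: c_def sum_distrib_right)
    also have "\<dots> = (\<Sum>i<d. \<Sum>l<d. (A ^\<^sub>m k) $$ (i, l) * A $$ (l, j))"
      by (rule sum.swap)
    also have "\<dots> = c (Suc k) j"
      unfolding c_def using j A Ak
      by (intro sum.cong) (auto simp: scalar_prod_def atLeast0LessThan)
    finally show ?thesis .
  qed
  have cN: "c N j < 1" if j: "j < d" for j
  proof -
    have "c N j < (\<Sum>i<d. 1 / real d)"
      unfolding c_def
    proof (rule sum_strict_mono)
      show "{..<d} \<noteq> {}" using d by (auto intro: exI[of _ 0])
    qed (use N j in \<open>force simp: abs_less_iff\<close>)+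
    then show ?thesis using d by simp
  qed
  have N0: "0 < N"
    using cN[OF d] c0[OF d] by (cases N) auto
  have "0 < b j \<and> (\<Sum>i<d. b i * A $$ (i, j)) < b j" if j: "j < d" for j
  proof
    have "c 0 j \<le> b j"
      unfolding b_def using N0 c_nonneg j by (intro member_le_sum) auto
    then show "0 < b j" using c0[OF j] by simp
    have "(\<Sum>i<d. b i * A $$ (i, j)) = (\<Sum>i<d. \<Sum>k<N. c k i * A $$ (i, j))"
      by (simp add: b_def sum_distrib_right)
    also have "\<dots> = (\<Sum>k<N. \<Sum>i<d. c k i * A $$ (i, j))"
      by (rule sum.swap)
    also have "\<dots> = (\<Sum>k<N. c (Suc k) j)"
      using c_Suc[OF j] by simp
    also have "\<dots> = b j + c N j - c 0 j"
      using sum.lessThan_Suc_shift[of "\<lambda>k. c k j" N] by (simp add: b_def)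
    finally show "(\<Sum>i<d. b i * A $$ (i, j)) < b j"
      using cN[OF j] c0[OF j] by simp
  qed
  then show ?thesis by blast
qed

lemma spectral_radius_transpose:
  assumes "B \<in> carrier_mat d d"
  shows "spectral_radius (transpose_mat B) = spectral_radius B"
  using assms
  by (simp add: spectral_radius_def spectrum_root_char_poly[of _ d] char_poly_transpose_mat[of _ d])


section \<open>Multi-homogeneous order-preserving maps\<close>

lemma K_plusD:
  assumes "x \<in> K_plus d n"
  shows "i < d \<Longrightarrow> x i \<in> block_space (n i)" "\<not> (i < d \<and> j < n i) \<Longrightarrow> x i j = 0" "0 \<le> x i j"
  using assms
  by (auto simp: K_plus_def product_space_def block_space_def)
    (metis linorder_not_less order_refl)+

lemma K_plusI:
  assumes "\<And>i j. i < d \<Longrightarrow> j < n i \<Longrightarrow> 0 \<le> x i j"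
    and "\<And>i j. \<not> (i < d \<and> j < n i) \<Longrightarrow> x i j = 0"
  shows "x \<in> K_plus d n"
  using assms by (auto simp: K_plus_def product_space_def block_space_def)

lemma K_pos_iff: "x \<in> K_pos d n \<longleftrightarrow> x \<in> K_plus d n \<and> (\<forall>i<d. \<forall>j<n i. 0 < x i j)"
  by (auto simp: K_pos_def K_plus_def intro: less_imp_le)

lemma block_scale_in_K_plus:
  assumes "\<alpha> \<in> pos_vec d" "x \<in> K_plus d n"
  shows "\<alpha> \<otimes>\<^sub>b x \<in> K_plus d n"
  using assms K_plusD[OF assms(2)]
  by (intro K_plusI) (auto simp: block_scale_def pos_vec_def less_imp_le)

lemma ones_in_K_plus: "ones d n \<in> K_plus d n"
  by (intro K_plusI) (auto simp: ones_def)

lemma multi_homogeneousD: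
  assumes "multi_homogeneous d n F A" "x \<in> K_plus d n" "\<alpha> \<in> pos_vec d" "i < d"
  shows "F (\<alpha> \<otimes>\<^sub>b x) i j = (\<Prod>k<d. (\<alpha> $ k) powr (A $$ (i, k))) * F x i j"
proof -
  have "A \<in> carrier_mat d d" and F_eq: "F (\<alpha> \<otimes>\<^sub>b x) = vec_powr \<alpha> A \<otimes>\<^sub>b F x"
    using assms by (auto simp: multi_homogeneous_def)
  then show ?thesis
    unfolding F_eq using assms(4) by (auto simp: block_scale_def vec_powr_def)
qed

text \<open>Doubling one block of the all-ones vector does not decrease the image.\<close>

lemma homogeneity_matrix_nonneg:
  assumes n: "\<forall>i<d. 1 \<le> n i"
    and mono: "mono_on (K_plus d n) F"
    and F1: "F (ones d n) \<in> K_pos d n"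
    and hom: "multi_homogeneous d n F A"
    and i: "i < d" and k: "k < d"
  shows "0 \<le> A $$ (i, k)"
proof -
  define \<alpha> :: "real vec" where "\<alpha> = vec d (\<lambda>l. if l = k then 2 else 1)"
  have \<alpha>: "\<alpha> \<in> pos_vec d"
    by (auto simp: \<alpha>_def pos_vec_def)
  have "ones d n \<le> \<alpha> \<otimes>\<^sub>b ones d n"
    by (auto simp: le_fun_def block_scale_def ones_def \<alpha>_def)
  then have "F (ones d n) \<le> F (\<alpha> \<otimes>\<^sub>b ones d n)"
    using mono ones_in_K_plus block_scale_in_K_plus[OF \<alpha> ones_in_K_plus]
    by (auto simp: mono_on_def)
  then have "F (ones d n) i 0 \<le> (\<Prod>l<d. (\<alpha> $ l) powr (A $$ (i, l))) * F (ones d n) i 0"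
    using multi_homogeneousD[OF hom ones_in_K_plus \<alpha> i, of 0] by (simp add: le_fun_def) metis
  moreover have "0 < F (ones d n) i 0"
    using F1 i n by (fastforce simp: K_pos_iff)
  ultimately have "1 \<le> (\<Prod>l<d. (\<alpha> $ l) powr (A $$ (i, l)))"
    by simp
  also have "\<dots> = (\<Prod>l<d. if l = k then 2 powr (A $$ (i, l)) else 1)"
    by (intro prod.cong) (auto simp: \<alpha>_def)
  also have "\<dots> = 2 powr (A $$ (i, k))"
    using k by simp
  finally show ?thesis
    using powr_less_one[of 2 "A $$ (i, k)"] by linarith
qed


section \<open>A positive fixed point\<close>

text \<open>
  The argument of Knaster and Tarski, as an order interval of the cone is a complete lattice: the
  least upper bound of the points with \<open>x \<le> F x\<close> in the interval is a fixed point.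
\<close>

lemma fixed_point_in_order_interval:
  assumes maps: "F \<in> K_plus d n \<rightarrow> K_plus d n"
    and mono: "mono_on (K_plus d n) F"
    and lo: "lo \<in> K_plus d n" and hi: "hi \<in> K_plus d n"
    and "lo \<le> hi" and Flo: "lo \<le> F lo" and Fhi: "F hi \<le> hi"
  shows "\<exists>u\<in>K_plus d n. lo \<le> u \<and> F u = u"
proof -
  define P where "P = {x \<in> K_plus d n. lo \<le> x \<and> x \<le> hi \<and> x \<le> F x}"
  define u where "u i j = (SUP x\<in>P. x i j)" for i j
  have F_mono: "F x \<le> F y" if "x \<in> K_plus d n" "y \<in> K_plus d n" "x \<le> y" for x y
    using mono that by (auto simp: mono_on_def)
  have lo_P: "lo \<in> P"
    using assms by (auto simp: P_def)
  have bdd: "bdd_above ((\<lambda>x. x i j) ` P)" for i j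
    by (rule bdd_aboveI2[of _ _ "hi i j"]) (auto simp: P_def le_fun_def)
  have upper: "x \<le> u" if "x \<in> P" for x
    unfolding u_def le_fun_def using bdd that by (auto intro: cSUP_upper)
  have least: "u \<le> y" if "\<And>x. x \<in> P \<Longrightarrow> x \<le> y" for y
    unfolding u_def le_fun_def using that lo_P by (auto intro!: cSUP_least simp: le_fun_def)
  have u_hi: "u \<le> hi"
    by (rule least) (auto simp: P_def)
  have u: "u \<in> K_plus d n"
  proof (rule K_plusI)
    show "0 \<le> u i j" if "i < d" "j < n i" for i j
      using upper[OF lo_P] K_plusD(3)[OF lo, of i j] by (auto simp: le_fun_def intro: order_trans)
    show "u i j = 0" if "\<not> (i < d \<and> j < n i)" for i j
      using upper[OF lo_P] u_hi K_plusD(2)[OF lo that] K_plusD(2)[OF hi that]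
      by (metis le_fun_def order_antisym)
  qed
  have Fu: "F u \<in> K_plus d n"
    using maps u by auto
  have u_Fu: "u \<le> F u"
  proof (rule least)
    fix x assume x: "x \<in> P"
    then have "x \<le> F x" by (simp add: P_def)
    also have "F x \<le> F u"
      using x u upper[OF x] by (intro F_mono) (auto simp: P_def)
    finally show "x \<le> F u" .
  qed
  have "F u \<in> P"
  proof -
    have "lo \<le> F u" using upper[OF lo_P] u_Fu by (rule order_trans)
    moreover have "F u \<le> hi" using F_mono[OF u hi u_hi] Fhi by (rule order_trans)
    moreover have "F u \<le> F (F u)" using F_mono[OF u Fu u_Fu] .
    ultimately show ?thesis using Fu by (simp add: P_def)
  qed
  then have "F u \<le> u" by (rule upper)
  then show ?thesis
    using u u_Fu upper[OF lo_P] by (intro bexI[of _ u]) auto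
qed

text \<open>
  In logarithmic coordinates \<open>F\<close> sends the scaling exponent \<open>s v\<close> of the all-ones vector to
  \<open>s A v\<close>, up to the bounded error \<open>ln F(1)\<close>.  If \<open>A v < v\<close>, then the gap \<open>s (v - A v)\<close> absorbs
  the error for large \<open>s\<close>, so that the scalings of the all-ones vector by \<open>exp (- s v)\<close> and
  \<open>exp (s v)\<close> bound an order interval that \<open>F\<close> maps into itself.
\<close>

lemma ex_positive_fixed_point:
  assumes maps: "F \<in> K_plus d n \<rightarrow> K_plus d n"
    and mono: "mono_on (K_plus d n) F"
    and F1: "F (ones d n) \<in> K_pos d n"
    and hom: "multi_homogeneous d n F A"
    and v: "\<And>i. i < d \<Longrightarrow> 0 < v i"
    and Av: "\<And>i. i < d \<Longrightarrow> (\<Sum>k<d. A $$ (i, k) * v k) < v i"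
  shows "\<exists>u\<in>K_pos d n. F u = u"
proof -
  define w where "w i = (\<Sum>k<d. A $$ (i, k) * v k)" for i
  define E where "E s = vec d (\<lambda>i. exp (s * v i))" for s
  have E: "E s \<in> pos_vec d" for s
    by (auto simp: E_def pos_vec_def)
  have E_ones: "E s \<otimes>\<^sub>b ones d n \<in> K_plus d n" for s
    using block_scale_in_K_plus[OF E ones_in_K_plus] .
  have E_ones_eq: "(E s \<otimes>\<^sub>b ones d n) i j = (if i < d \<and> j < n i then exp (s * v i) else 0)" for s i j
    by (auto simp: block_scale_def ones_def E_def)
  have F_pos: "0 < F (ones d n) i j" if "i < d" "j < n i" for i j
    using F1 that by (simp add: K_pos_iff)
  have F_E: "F (E s \<otimes>\<^sub>b ones d n) i j = exp (s * w i + ln (F (ones d n) i j))"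
    if ij: "i < d" "j < n i" for s i j
  proof -
    have "(\<Prod>k<d. (E s $ k) powr (A $$ (i, k))) = (\<Prod>k<d. exp (s * (A $$ (i, k) * v k)))"
      by (intro prod.cong) (auto simp: E_def powr_def ac_simps)
    also have "\<dots> = exp (s * w i)"
      by (simp add: exp_sum w_def sum_distrib_left)
    finally show ?thesis
      using multi_homogeneousD[OF hom ones_in_K_plus E ij(1), of s j] F_pos[OF ij]
      by (simp add: exp_add)
  qed
  \<comment> \<open>All summands are nonnegative, so the sum bounds each of them.\<close>
  define t where "t = (\<Sum>i<d. \<Sum>j<n i. \<bar>ln (F (ones d n) i j)\<bar> / (v i - w i))"
  have gap: "0 < v i - w i" if "i < d" for i
    using Av[OF that] by (simp add: w_def)
  have t0: "0 \<le> t"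
    unfolding t_def using gap by (intro sum_nonneg divide_nonneg_pos) auto
  have t: "\<bar>ln (F (ones d n) i j)\<bar> \<le> t * (v i - w i)" if ij: "i < d" "j < n i" for i j
  proof -
    have "\<bar>ln (F (ones d n) i j)\<bar> / (v i - w i)
        \<le> (\<Sum>j<n i. \<bar>ln (F (ones d n) i j)\<bar> / (v i - w i))"
      using ij gap by (intro member_le_sum) (auto intro!: divide_nonneg_pos)
    also have "\<dots> \<le> t"
      unfolding t_def using ij gap
      by (intro member_le_sum[of i "{..<d}" "\<lambda>i. \<Sum>j<n i. \<bar>ln (F (ones d n) i j)\<bar> / (v i - w i)"])
        (auto intro!: divide_nonneg_pos sum_nonneg)
    finally show ?thesis
      using gap[OF ij(1)] by (simp add: field_simps)
  qed
  have le: "(E (- t) \<otimes>\<^sub>b ones d n) \<le> (E t \<otimes>\<^sub>b ones d n)"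
  proof (intro le_funI)
    fix i j
    show "(E (- t) \<otimes>\<^sub>b ones d n) i j \<le> (E t \<otimes>\<^sub>b ones d n) i j"
      using mult_nonneg_nonneg[OF t0, of "v i"] v[of i] by (auto simp: E_ones_eq)
  qed
  have F_zero: "F (E s \<otimes>\<^sub>b ones d n) i j = 0" if "\<not> (i < d \<and> j < n i)" for s i j
    using K_plusD(2)[of "F (E s \<otimes>\<^sub>b ones d n)" d n i j] maps E_ones that by blast
  have lower: "(E (- t) \<otimes>\<^sub>b ones d n) \<le> F (E (- t) \<otimes>\<^sub>b ones d n)"
  proof (intro le_funI)
    fix i j
    show "(E (- t) \<otimes>\<^sub>b ones d n) i j \<le> F (E (- t) \<otimes>\<^sub>b ones d n) i j"
      using t[of i j] F_zero[of i j "- t"]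
      by (cases "i < d \<and> j < n i") (auto simp: F_E E_ones_eq algebra_simps abs_le_iff)
  qed
  have upper: "F (E t \<otimes>\<^sub>b ones d n) \<le> (E t \<otimes>\<^sub>b ones d n)"
  proof (intro le_funI)
    fix i j
    show "F (E t \<otimes>\<^sub>b ones d n) i j \<le> (E t \<otimes>\<^sub>b ones d n) i j"
      using t[of i j] F_zero[of i j t]
      by (cases "i < d \<and> j < n i") (auto simp: F_E E_ones_eq algebra_simps abs_le_iff)
  qed
  obtain u where u: "u \<in> K_plus d n" "(E (- t) \<otimes>\<^sub>b ones d n) \<le> u" "F u = u"
    using fixed_point_in_order_interval[OF maps mono E_ones E_ones le lower upper] by blast
  have "0 < u i j" if "i < d" "j < n i" for i j
  proof -
    have "0 < (E (- t) \<otimes>\<^sub>b ones d n) i j" using that by (simp add: E_ones_eq)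
    also have "\<dots> \<le> u i j" using u(2) by (simp add: le_fun_def)
    finally show ?thesis .
  qed
  with u show ?thesis by (auto simp: K_pos_iff)
qed

text \<open>
  By homogeneity, rescaling the blocks of an eigenvector gives an eigenvector again, with other
  eigenvalues.
\<close>

lemma ex_normalized_eigenvector:
  assumes n: "\<forall>i<d. 1 \<le> n i"
    and \<gamma>: "\<forall>i<d. monotonic_norm_on (n i) (\<gamma> i)"
    and hom: "multi_homogeneous d n F A"
    and w: "w \<in> K_pos d n" and Fw: "F w = w"
  shows "\<exists>l\<in>pos_vec d. \<exists>u\<in>S_pos d n \<gamma>. F u = l \<otimes>\<^sub>b u"
proof -
  have wK: "w \<in> K_plus d n" and w_pos: "\<And>i j. i < d \<Longrightarrow> j < n i \<Longrightarrow> 0 < w i j"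
    using w by (auto simp: K_pos_iff)
  have norm: "is_norm_on (n i) (\<gamma> i)" if "i < d" for i
    using \<gamma> that by (simp add: monotonic_norm_on_def)
  have \<gamma>_pos: "0 < \<gamma> i (w i)" if i: "i < d" for i
  proof -
    have "0 < w i 0"
      using w_pos[OF i, of 0] n i by fastforce
    then have "w i \<noteq> (\<lambda>_. 0)"
      by auto
    then show ?thesis
      using norm[OF i] K_plusD(1)[OF wK i] by (force simp: is_norm_on_def)
  qed
  define \<beta> where "\<beta> = vec d (\<lambda>i. 1 / \<gamma> i (w i))"
  define l where "l = vec d (\<lambda>i. (\<Prod>k<d. (\<beta> $ k) powr (A $$ (i, k))) / \<beta> $ i)"
  define u where "u = \<beta> \<otimes>\<^sub>b w"
  have \<beta>: "\<beta> \<in> pos_vec d"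
    using \<gamma>_pos by (auto simp: \<beta>_def pos_vec_def)
  have \<beta>_pos: "0 < \<beta> $ i" if "i < d" for i
    using \<beta> that by (simp add: pos_vec_def)
  have l: "l \<in> pos_vec d"
    using \<beta>_pos by (auto simp: l_def pos_vec_def intro!: divide_pos_pos prod_pos) (fastforce dest: \<beta>_pos)
  have u_eq: "u i = (\<lambda>j. \<beta> $ i * w i j)" if "i < d" for i
    using that by (auto simp: u_def block_scale_def \<beta>_def)
  have uK: "u \<in> K_plus d n"
    using block_scale_in_K_plus[OF \<beta> wK] by (simp add: u_def)
  have "\<gamma> i (u i) = 1" if i: "i < d" for i
  proof -
    have "\<gamma> i (u i) = \<bar>\<beta> $ i\<bar> * \<gamma> i (w i)"
      using norm[OF i] K_plusD(1)[OF wK i] by (simp add: is_norm_on_def u_eq[OF i])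
    then show ?thesis
      using \<gamma>_pos[OF i] i by (simp add: \<beta>_def)
  qed
  moreover have "0 < u i j" if "i < d" "j < n i" for i j
    using that w_pos \<beta>_pos by (simp add: u_eq)
  ultimately have "u \<in> S_pos d n \<gamma>"
    using uK by (simp add: S_pos_def S_plus_def K_pos_iff)
  moreover have "F u = l \<otimes>\<^sub>b u"
  proof (intro ext)
    fix i j
    have F_u: "F u = vec_powr \<beta> A \<otimes>\<^sub>b w"
      using hom wK \<beta> Fw by (simp add: multi_homogeneous_def u_def)
    have "dim_row A = d" "dim_col A = d"
      using hom by (auto simp: multi_homogeneous_def)
    then show "F u i j = (l \<otimes>\<^sub>b u) i j"
      unfolding F_u using \<beta>_pos[of i]
      by (auto simp: block_scale_def vec_powr_def l_def u_eq)
  qed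
  ultimately show ?thesis using l by blast
qed


section \<open>Collatz-Wielandt bounds\<close>

text \<open>
  Both Collatz-Wielandt inequalities are instances of this comparison, with \<open>(x, y)\<close> being
  (eigenvector, arbitrary point) and (arbitrary point, eigenvector).
  Scale the blocks of \<open>y\<close> by the least \<open>\<alpha>\<close> for which \<open>x \<le> \<alpha> \<otimes> y\<close>.  Evaluating
  \<open>F x \<le> \<alpha>\<^sup>A \<otimes> F y\<close> at a coordinate of contact in each block gives \<open>\<nu> \<alpha> \<le> \<alpha>\<^sup>A \<mu>\<close>.  In the
  product weighted by \<open>b\<close>, \<open>\<alpha>\<^sup>A\<close> contributes the exponent \<open>A\<^sup>T b \<le> b\<close>, and \<open>\<alpha> \<ge> 1\<close> as the blocks
  of \<open>x\<close> and \<open>y\<close> have equal monotonic norms, so it is dominated by the factor from \<open>\<alpha>\<close> on the left.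
\<close>

lemma weighted_growth_comparison:
  assumes n: "\<forall>i<d. 1 \<le> n i"
    and \<gamma>: "\<forall>i<d. monotonic_norm_on (n i) (\<gamma> i)"
    and mono: "mono_on (K_plus d n) F"
    and hom: "multi_homogeneous d n F A"
    and b: "\<And>i. i < d \<Longrightarrow> 0 < b i"
    and Ab: "\<And>k. k < d \<Longrightarrow> (\<Sum>i<d. b i * A $$ (i, k)) \<le> b k"
    and x: "x \<in> S_plus d n \<gamma>" and y: "y \<in> S_pos d n \<gamma>"
    and \<nu>: "\<And>i. i < d \<Longrightarrow> 0 \<le> \<nu> i"
    and Fx: "\<And>i j. i < d \<Longrightarrow> j < n i \<Longrightarrow> 0 < x i j \<Longrightarrow> \<nu> i * x i j \<le> F x i j"
    and Fy: "\<And>i j. i < d \<Longrightarrow> j < n i \<Longrightarrow> F y i j \<le> \<mu> i * y i j"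
  shows "(\<Prod>i<d. \<nu> i powr b i) \<le> (\<Prod>i<d. \<mu> i powr b i)"
proof -
  have xK: "x \<in> K_plus d n" and yK: "y \<in> K_plus d n"
    and y_pos: "\<And>i j. i < d \<Longrightarrow> j < n i \<Longrightarrow> 0 < y i j"
    and x1: "\<And>i. i < d \<Longrightarrow> \<gamma> i (x i) = 1" and y1: "\<And>i. i < d \<Longrightarrow> \<gamma> i (y i) = 1"
    using x y by (auto simp: S_pos_def S_plus_def K_pos_iff)
  have "\<exists>j<n i. \<forall>j'<n i. x i j' / y i j' \<le> x i j / y i j" if i: "i < d" for i
  proof -
    let ?R = "(\<lambda>j. x i j / y i j) ` {..<n i}"
    have "?R \<noteq> {}" using n i by (auto simp: lessThan_empty_iff)
    then have "Max ?R \<in> ?R" by simp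
    then obtain j where j: "j < n i" "Max ?R = x i j / y i j" by auto
    have "x i j' / y i j' \<le> Max ?R" if "j' < n i" for j'
      using that by (intro Max_ge) auto
    with j show ?thesis by auto
  qed
  then obtain J where J: "\<And>i. i < d \<Longrightarrow> J i < n i"
    and J_max: "\<And>i j. i < d \<Longrightarrow> j < n i \<Longrightarrow> x i j / y i j \<le> x i (J i) / y i (J i)"
    by metis
  define a where "a i = x i (J i) / y i (J i)" for i
  have x_le: "x i j \<le> a i * y i j" if "i < d" "j < n i" for i j
    using J_max[OF that] y_pos[OF that] by (simp add: a_def field_simps)
  have x_J: "x i (J i) = a i * y i (J i)" if "i < d" for i
    using y_pos[OF that J[OF that]] by (simp add: a_def)
  have a1: "1 \<le> a i" if i: "i < d" for i
  proof -
    have a0: "0 \<le> a i"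
      using K_plusD(3)[OF xK] K_plusD(3)[OF yK] by (simp add: a_def)
    have xb: "x i \<in> block_space (n i)" and yb: "y i \<in> block_space (n i)"
      using K_plusD(1)[OF xK i] K_plusD(1)[OF yK i] by auto
    have ayb: "(\<lambda>j. a i * y i j) \<in> block_space (n i)"
      using yb by (simp add: block_space_def)
    have "x i \<le> (\<lambda>j. a i * y i j)"
    proof (intro le_funI)
      fix j
      show "x i j \<le> a i * y i j"
        using x_le[OF i, of j] K_plusD(2)[OF xK, of i j] K_plusD(2)[OF yK, of i j]
        by (cases "j < n i") auto
    qed
    moreover have "(\<lambda>_. 0) \<le> x i"
      using K_plusD(3)[OF xK] by (simp add: le_fun_def)
    ultimately have "\<gamma> i (x i) \<le> \<gamma> i (\<lambda>j. a i * y i j)"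
      using \<gamma> i xb ayb unfolding monotonic_norm_on_def by blast
    also have "\<dots> = \<bar>a i\<bar> * \<gamma> i (y i)"
      using \<gamma> i yb unfolding monotonic_norm_on_def is_norm_on_def by blast
    finally show ?thesis using a0 x1[OF i] y1[OF i] by simp
  qed
  define \<alpha> where "\<alpha> = vec d a"
  have \<alpha>: "\<alpha> \<in> pos_vec d"
    using a1 by (force simp: \<alpha>_def pos_vec_def)
  have "x \<le> \<alpha> \<otimes>\<^sub>b y"
  proof (intro le_funI)
    fix i j
    show "x i j \<le> (\<alpha> \<otimes>\<^sub>b y) i j"
      using x_le[of i j] K_plusD(2)[OF xK, of i j] K_plusD(2)[OF yK, of i j]
      by (cases "i < d \<and> j < n i") (auto simp: block_scale_def \<alpha>_def)
  qed
  then have F_le: "F x \<le> F (\<alpha> \<otimes>\<^sub>b y)"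
    using mono xK block_scale_in_K_plus[OF \<alpha> yK] by (auto simp: mono_on_def)
  define p where "p i = (\<Prod>k<d. a k powr (A $$ (i, k)))" for i
  have p_pos: "0 < p i" for i
    unfolding p_def using a1 by (intro prod_pos) fastforce
  have contact: "\<nu> i * a i \<le> p i * \<mu> i" if i: "i < d" for i
  proof -
    have y0: "0 < y i (J i)" using y_pos[OF i J[OF i]] .
    have x0: "0 < x i (J i)" using x_J[OF i] y0 a1[OF i] by simp
    have "\<nu> i * (a i * y i (J i)) \<le> F x i (J i)"
      using Fx[OF i J[OF i] x0] by (simp add: x_J[OF i])
    also have "\<dots> \<le> F (\<alpha> \<otimes>\<^sub>b y) i (J i)"
      using F_le by (simp add: le_fun_def)
    also have "\<dots> = p i * F y i (J i)"
      using multi_homogeneousD[OF hom yK \<alpha> i] by (simp add: p_def \<alpha>_def)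
    also have "\<dots> \<le> p i * (\<mu> i * y i (J i))"
      using Fy[OF i J[OF i]] p_pos[of i] by simp
    finally have "(\<nu> i * a i) * y i (J i) \<le> (p i * \<mu> i) * y i (J i)"
      by (simp add: mult.assoc)
    then show ?thesis using y0 by simp
  qed
  have p_prod: "(\<Prod>i<d. p i powr b i) \<le> (\<Prod>k<d. a k powr b k)"
  proof -
    have "(\<Prod>i<d. p i powr b i) = (\<Prod>i<d. \<Prod>k<d. a k powr (b i * A $$ (i, k)))"
      using a1 by (intro prod.cong) (auto simp: p_def prod_powr_distrib powr_powr ac_simps)
    also have "\<dots> = (\<Prod>k<d. \<Prod>i<d. a k powr (b i * A $$ (i, k)))"
      by (rule prod.swap)
    also have "\<dots> = (\<Prod>k<d. a k powr (\<Sum>i<d. b i * A $$ (i, k)))"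
      using a1 by (intro prod.cong) (fastforce simp: powr_sum)+
    also have "\<dots> \<le> (\<Prod>k<d. a k powr b k)"
      using a1 Ab by (intro prod_mono) (auto intro!: powr_mono)
    finally show ?thesis .
  qed
  have a_prod: "0 < (\<Prod>k<d. a k powr b k)"
    using a1 by (intro prod_pos) fastforce
  have "(\<Prod>i<d. \<nu> i powr b i) * (\<Prod>i<d. a i powr b i) = (\<Prod>i<d. (\<nu> i * a i) powr b i)"
    by (simp add: powr_mult prod.distrib)
  also have "\<dots> \<le> (\<Prod>i<d. (p i * \<mu> i) powr b i)"
  proof (intro prod_mono conjI)
    fix i assume "i \<in> {..<d}"
    then have i: "i < d" by simp
    show "(\<nu> i * a i) powr b i \<le> (p i * \<mu> i) powr b i"
      using contact[OF i] b[OF i] \<nu>[OF i] a1[OF i] by (intro powr_mono2) auto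
  qed auto
  also have "\<dots> = (\<Prod>i<d. p i powr b i) * (\<Prod>i<d. \<mu> i powr b i)"
    by (simp add: powr_mult prod.distrib)
  also have "\<dots> \<le> (\<Prod>k<d. a k powr b k) * (\<Prod>i<d. \<mu> i powr b i)"
    using p_prod by (intro mult_right_mono prod_nonneg) auto
  finally show ?thesis
    using a_prod by (simp add: mult.commute)
qed

lemma S_plus_nonzero_entry:
  assumes \<gamma>: "\<forall>i<d. monotonic_norm_on (n i) (\<gamma> i)"
    and x: "x \<in> S_plus d n \<gamma>" and i: "i < d"
  shows "\<exists>j<n i. 0 < x i j"
proof (rule ccontr)
  assume neg: "\<not> ?thesis"
  have xK: "x \<in> K_plus d n" and x1: "\<gamma> i (x i) = 1"
    using x i by (auto simp: S_plus_def)
  have "x i j = 0" for j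
    using neg K_plusD(2)[OF xK, of i j] K_plusD(3)[OF xK, of i j] by (cases "j < n i") force+
  then have "x i = (\<lambda>_. 0)" by blast
  moreover have "\<gamma> i (x i) = 0 \<longleftrightarrow> x i = (\<lambda>_. 0)"
    using \<gamma> i K_plusD(1)[OF xK i] unfolding monotonic_norm_on_def is_norm_on_def by blast
  ultimately show False
    using x1 by simp
qed

lemma transpose_subinvariant_iff:
  fixes A :: "real mat"
  assumes A: "A \<in> carrier_mat d d" and b: "b \<in> carrier_vec d"
  shows "transpose_mat A *\<^sub>v b \<le> b \<longleftrightarrow> (\<forall>k<d. (\<Sum>i<d. b $ i * A $$ (i, k)) \<le> b $ k)"
  using A b
  by (auto simp: less_eq_vec_def scalar_prod_def atLeast0LessThan mult.commute)

lemma collatz_wielandt_extrema: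
  assumes n: "\<forall>i<d. 1 \<le> n i"
    and \<gamma>: "\<forall>i<d. monotonic_norm_on (n i) (\<gamma> i)"
    and maps: "F \<in> K_plus d n \<rightarrow> K_plus d n"
    and mono: "mono_on (K_plus d n) F"
    and hom: "multi_homogeneous d n F A"
    and b: "b \<in> pos_vec d" and Ab: "transpose_mat A *\<^sub>v b \<le> b"
    and l: "l \<in> pos_vec d" and u: "u \<in> S_pos d n \<gamma>" and Fu: "F u = l \<otimes>\<^sub>b u"
  shows "is_minimum_over (S_pos d n \<gamma>) (cw_upper d n b F) (\<Prod>i<d. (l $ i) powr (b $ i))"
    and "is_maximum_over (S_plus d n \<gamma>) (cw_lower d n b F) (\<Prod>i<d. (l $ i) powr (b $ i))"
proof -
  have A: "A \<in> carrier_mat d d" using hom by (simp add: multi_homogeneous_def)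
  have b_pos: "\<And>i. i < d \<Longrightarrow> 0 < b $ i" and b_carrier: "b \<in> carrier_vec d"
    using b by (auto simp: pos_vec_def)
  have sub: "\<And>k. k < d \<Longrightarrow> (\<Sum>i<d. b $ i * A $$ (i, k)) \<le> b $ k"
    using Ab transpose_subinvariant_iff[OF A b_carrier] by simp
  have uS: "u \<in> S_plus d n \<gamma>" and u_pos: "\<And>i j. i < d \<Longrightarrow> j < n i \<Longrightarrow> 0 < u i j"
    using u by (auto simp: S_pos_def K_pos_iff)
  have l_pos: "\<And>i. i < d \<Longrightarrow> 0 < l $ i" and dim_l: "dim_vec l = d"
    using l by (auto simp: pos_vec_def)
  have Fu_eq: "F u i j = l $ i * u i j" if "i < d" for i j
    using that by (simp add: Fu block_scale_def dim_l)
  have ratios: "(\<lambda>j. F u i j / u i j) ` {j. j < n i \<and> 0 < u i j} = {l $ i}" if i: "i < d" for i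
  proof -
    have "F u i j / u i j = l $ i" if "0 < u i j" for j
      using that by (simp add: Fu_eq[OF i])
    moreover have "{j. j < n i \<and> 0 < u i j} \<noteq> {}"
      using S_plus_nonzero_entry[OF \<gamma> uS i] by auto
    ultimately show ?thesis by (auto simp: image_iff)
  qed
  note compare = weighted_growth_comparison[where b = "\<lambda>i. b $ i", OF n \<gamma> mono hom b_pos sub]
  show "is_minimum_over (S_pos d n \<gamma>) (cw_upper d n b F) (\<Prod>i<d. (l $ i) powr (b $ i))"
    unfolding is_minimum_over_def
  proof
    have "{F u i j / u i j | j. j < n i} = {l $ i}" if i: "i < d" for i
    proof -
      have "{F u i j / u i j | j. j < n i} = (\<lambda>j. F u i j / u i j) ` {j. j < n i \<and> 0 < u i j}"
        using u_pos[OF i] by auto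
      then show ?thesis using ratios[OF i] by simp
    qed
    then have "cw_upper d n b F u = (\<Prod>i<d. (l $ i) powr (b $ i))"
      by (simp add: cw_upper_def)
    with u show "(\<Prod>i<d. (l $ i) powr (b $ i)) \<in> cw_upper d n b F ` S_pos d n \<gamma>"
      by (metis imageI)
    show "\<forall>x\<in>S_pos d n \<gamma>. (\<Prod>i<d. (l $ i) powr (b $ i)) \<le> cw_upper d n b F x"
    proof
      fix x assume x: "x \<in> S_pos d n \<gamma>"
      have "F x i j \<le> Max {F x i j / x i j | j. j < n i} * x i j" if ij: "i < d" "j < n i" for i j
      proof -
        have "0 < x i j" using x ij by (auto simp: S_pos_def K_pos_iff)
        moreover have "F x i j / x i j \<le> Max {F x i j / x i j | j. j < n i}"
          using ij by (intro Max_ge) auto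
        ultimately show ?thesis by (simp add: field_simps)
      qed
      then show "(\<Prod>i<d. (l $ i) powr (b $ i)) \<le> cw_upper d n b F x"
        unfolding cw_upper_def
        by (intro compare[OF _ _ uS x]) (auto simp: Fu_eq l_pos less_imp_le)
    qed
  qed
  show "is_maximum_over (S_plus d n \<gamma>) (cw_lower d n b F) (\<Prod>i<d. (l $ i) powr (b $ i))"
    unfolding is_maximum_over_def
  proof
    have "{F u i j / u i j | j. j < n i \<and> 0 < u i j} = {l $ i}" if i: "i < d" for i
      using ratios[OF i] by (simp add: setcompr_eq_image)
    then have "cw_lower d n b F u = (\<Prod>i<d. (l $ i) powr (b $ i))"
      by (simp add: cw_lower_def)
    with uS show "(\<Prod>i<d. (l $ i) powr (b $ i)) \<in> cw_lower d n b F ` S_plus d n \<gamma>"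
      by (metis imageI)
    show "\<forall>x\<in>S_plus d n \<gamma>. cw_lower d n b F x \<le> (\<Prod>i<d. (l $ i) powr (b $ i))"
    proof
      fix x assume x: "x \<in> S_plus d n \<gamma>"
      let ?Q = "\<lambda>i. {F x i j / x i j | j. j < n i \<and> 0 < x i j}"
      have "F x \<in> K_plus d n"
        using maps x by (auto simp: S_plus_def)
      then have Fx0: "0 \<le> F x i j" for i j
        using K_plusD(3) by blast
      have "0 \<le> Min (?Q i)" if i: "i < d" for i
      proof -
        have "?Q i \<noteq> {}" using S_plus_nonzero_entry[OF \<gamma> x i] by auto
        then have "Min (?Q i) \<in> ?Q i" by (intro Min_in) auto
        then show ?thesis using Fx0 by auto
      qed
      moreover have "Min (?Q i) * x i j \<le> F x i j" if ij: "i < d" "j < n i" "0 < x i j" for i j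
      proof -
        have "Min (?Q i) \<le> F x i j / x i j"
          using ij by (intro Min_le) auto
        then show ?thesis using ij by (simp add: field_simps)
      qed
      ultimately show "cw_lower d n b F x \<le> (\<Prod>i<d. (l $ i) powr (b $ i))"
        unfolding cw_lower_def
        by (intro compare[OF _ _ x u]) (auto simp: Fu_eq)
    qed
  qed
qed

theorem theorem4p2:
  fixes d :: nat
    and n :: "nat \<Rightarrow> nat"
    and \<gamma> :: "nat \<Rightarrow> (nat \<Rightarrow> real) \<Rightarrow> real"
    and F :: "(nat \<Rightarrow> nat \<Rightarrow> real) \<Rightarrow> nat \<Rightarrow> nat \<Rightarrow> real"
    and A :: "real mat"
  assumes "1 \<le> d"
    and "\<forall>i<d. 1 \<le> n i"
    and "\<forall>i<d. monotonic_norm_on (n i) (\<gamma> i)"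
    and "F \<in> H_class d n"
    and "multi_homogeneous d n F A"
    and "spectral_radius (map_mat complex_of_real A) < 1"
  shows "\<exists>l\<in>pos_vec d. \<exists>u\<in>S_pos d n \<gamma>.
           F u = l \<otimes>\<^sub>b u \<and>
           (\<exists>b\<in>pos_vec d. transpose_mat A *\<^sub>v b \<le> b) \<and>
           (\<forall>b\<in>pos_vec d. transpose_mat A *\<^sub>v b \<le> b \<longrightarrow>
              is_minimum_over (S_pos d n \<gamma>) (cw_upper d n b F) (\<Prod>i<d. (l $ i) powr (b $ i)) \<and>
              is_maximum_over (S_plus d n \<gamma>) (cw_lower d n b F) (\<Prod>i<d. (l $ i) powr (b $ i)))"
proof -
  have d: "0 < d" and n: "\<forall>i<d. 1 \<le> n i" and hom: "multi_homogeneous d n F A"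
    and \<gamma>: "\<forall>i<d. monotonic_norm_on (n i) (\<gamma> i)"
    and rad: "spectral_radius (map_mat complex_of_real A) < 1"
    using assms by auto
  have maps: "F \<in> K_plus d n \<rightarrow> K_plus d n" and mono: "mono_on (K_plus d n) F"
    and F1: "F (ones d n) \<in> K_pos d n"
    using \<open>F \<in> H_class d n\<close> by (auto simp: H_class_def)
  have A: "A \<in> carrier_mat d d"
    using hom by (simp add: multi_homogeneous_def)
  have A_nonneg: "\<And>i k. i < d \<Longrightarrow> k < d \<Longrightarrow> 0 \<le> A $$ (i, k)"
    using homogeneity_matrix_nonneg[OF n mono F1 hom] by blast
  have radT: "spectral_radius (map_mat complex_of_real (transpose_mat A)) < 1"
    using rad spectral_radius_transpose[of "map_mat complex_of_real A" d] A
    by (simp add: map_mat_transpose)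
  have AT: "transpose_mat A \<in> carrier_mat d d"
    using A by simp
  have AT_nonneg: "0 \<le> transpose_mat A $$ (i, j)" if "i < d" "j < d" for i j
    using A A_nonneg that by simp
  obtain v where v: "\<And>j. j < d \<Longrightarrow> 0 < v j"
    "\<And>j. j < d \<Longrightarrow> (\<Sum>i<d. v i * transpose_mat A $$ (i, j)) < v j"
    using ex_positive_strict_subinvariant[OF AT d AT_nonneg radT] by auto
  have Av: "(\<Sum>k<d. A $$ (i, k) * v k) < v i" if "i < d" for i
    using v(2)[OF that] A that by (simp add: mult.commute)
  obtain w where w: "w \<in> K_pos d n" "F w = w"
    using ex_positive_fixed_point[OF maps mono F1 hom v(1) Av] by blast
  obtain l u where lu: "l \<in> pos_vec d" "u \<in> S_pos d n \<gamma>" "F u = l \<otimes>\<^sub>b u"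
    using ex_normalized_eigenvector[OF n \<gamma> hom w] by blast
  obtain b where b: "\<And>j. j < d \<Longrightarrow> 0 < b j"
    "\<And>j. j < d \<Longrightarrow> (\<Sum>i<d. b i * A $$ (i, j)) < b j"
    using ex_positive_strict_subinvariant[OF A d A_nonneg rad] by auto
  have "vec d b \<in> pos_vec d" "transpose_mat A *\<^sub>v vec d b \<le> vec d b"
    using b by (auto simp: pos_vec_def transpose_subinvariant_iff[OF A] less_imp_le)
  then show ?thesis
    using lu collatz_wielandt_extrema[OF n \<gamma> maps mono hom _ _ lu] by blast
qed

end
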